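(* Let $g\in\mathcal C^2([0,\infty))$ satisfy $g(1)=0$, $g(0)\ge 0$, $g''<0$, and let $h(z)=g(z)/(1-z)$ for $0\le z<1$, $h(1)=-g'(1)$. For every value $D>0$ of the total drop there exists exactly one stationary traveling wave profile $\zeta(t,q)=Z(q)$, $q\in[-D,0]$, with total drop $D$ for the equation $$\zeta_t-(1-\zeta)^2\Big(h(\zeta)\exp\int_q^0 h(\zeta(t,s))\,ds\Big)_q=0 .$$
   Context: Background: $g$ is the erosion function $g(z)=zf(1/z)$ of a slow-erosion model, $\zeta\in[0,1]$ is the inverse slope of the granular profile as a function of the drop variable $q$, and $\zeta=0$ on an interval represents a vertical jump ("shock") of the profile. The constraint $\zeta\ge 0$ is imposed. The function $h$ is $\mathcal C^1$ on $[0,1]$, with $h'>0$. Let $\psi(s)=\frac{e^{h(0)s}-1}{s}$ for $s>0$, $\psi(0)=h(0)$ (so $\psi\equiv0$ if $h(0)=0$). Write $F(\zeta;q)=\exp\int_q^0h(\zeta(s))\,ds$. Front speeds of the evolution in the $(t,q)$ variables ($z^\mp$ denote left and right limits at the front): - Kink or hyper-kink (jump with $z^->z^+$, where $z^+>0$ for a kink and $z^+=0$ for a hyper-kink not followed by an interval of zeros): $\dot q=-F(\zeta;q)(1-z^+)(1-z^-)\frac{h(z^-)-h(z^+)}{z^--z^+}$. Among jumps between values that are not adjacent to an interval of zeros, only downward jumps ($z^->z^+$) are admissible. - Shock (maximal interval $(q^-,q^+)$ on which $\zeta=0$, of size $\Delta=q^+-q^->0$): the left front has speed $\dot q^-=F(\zeta;q^-)\frac{1-z^-}{z^-}\big[\psi(\Delta)e^{-h(0)\Delta}-h(z^-)\big]$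 and is always admissible; the right front has speed $\dot q^+=F(\zeta;q^+)\frac{1-z^+}{z^+}\big[\psi(\Delta)-h(z^+)\big]$ and is admissible iff $h(z^+)-z^+(1-z^+)h'(z^+)\le\psi(\Delta)$. The right front is stationary iff $h(z^+)=\psi(\Delta)$ or $z^+=1$; the left front is stationary iff $z^-=1$. A stationary traveling wave profile with total drop $D$ is a function $Z:[-D,0]\to[0,1]$ such that: 1. $Z(-D)=Z(0)=1$; $0\le Z<1$ on $(-D,0)$, and the one-sided limits of $Z$ at every point of $(-D,0)$ are also $<1$; $Z$ is left-continuous on $(-D,0)$ (a normalization of the values at jumps). 2. There is a finite partition of $[-D,0]$ such that on each open subinterval either $Z\equiv 0$, or $Z>0$ and $Z$ is $\mathcal C^1$ and solves the stationary equation $h'(Z)Z'=h^2(Z)$; $Z$ has one-sided limits at the partition points. 3. Every front of $Z$ (every kink, hyper-kink and both fronts of every shock) is stationary and admissible, meaning: every jump not adjacent to an interval of zeros is downward ($z^->z^+$) and has zero speed, $(1-z^+)(1-z^-)\frac{h(z^-)-h(z^+)}{z^--z^+}=0$, i.e. $z^-=1$; the left front of every shock has $z^-=1$; and the right front of every shock of size $\Delta$ satisfies both $h(z^+)-z^+(1-z^+)h'(z^+)\le\psi(\Delta)$ and ($h(z^+)=\psi(\Delta)$ or $z^+=1$). At the endpoint $q=-D$ the left value is $z^-=Z(-D)=1$, and at $q=0$ the right value is $z^+=Z(0)=1$; in particular an upward jump at $q=0$ is allowed only as the right front of a shock. *)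

theory Defs
  imports "HOL-Analysis.Analysis"
begin

definition erosion_h :: "(real \<Rightarrow> real) \<Rightarrow> real \<Rightarrow> real" where
  "erosion_h g z = (if z = 1 then - deriv g 1 else g z / (1 - z))"

text \<open>The derivative of \<open>h\<close> as a function on \<open>[0,1]\<close>, hence one-sided at \<open>0\<close> and \<open>1\<close>.\<close>

definition deriv01 :: "(real \<Rightarrow> real) \<Rightarrow> real \<Rightarrow> real" where
  "deriv01 h z = vector_derivative h (at z within {0..1})"

definition shock_psi :: "(real \<Rightarrow> real) \<Rightarrow> real \<Rightarrow> real" where
  "shock_psi h s = (if s = 0 then h 0 else (exp (h 0 * s) - 1) / s)"

text \<open>One-sided values on \<open>[-D,0]\<close>: the one-sided limit where the domain extends to that side,
  and the boundary value of the profile at \<open>-D\<close> (from the left) and at \<open>0\<close> (from the right).\<close>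

definition has_left_value :: "real \<Rightarrow> (real \<Rightarrow> real) \<Rightarrow> real \<Rightarrow> real \<Rightarrow> bool" where
  "has_left_value D Z q z \<longleftrightarrow> (if q = - D then z = Z q else (Z \<longlongrightarrow> z) (at_left q))"

definition has_right_value :: "(real \<Rightarrow> real) \<Rightarrow> real \<Rightarrow> real \<Rightarrow> bool" where
  "has_right_value Z q z \<longleftrightarrow> (if q = 0 then z = Z q else (Z \<longlongrightarrow> z) (at_right q))"

text \<open>A shock is a maximal open interval in \<open>[-D,0]\<close> on which \<open>Z\<close> vanishes.\<close>

definition zero_interval :: "real \<Rightarrow> (real \<Rightarrow> real) \<Rightarrow> real \<Rightarrow> real \<Rightarrow> bool" where
  "zero_interval D Z a b \<longleftrightarrow> - D \<le> a \<and> a < b \<and> b \<le> 0 \<and> (\<forall>q\<in>{a<..<b}. Z q = 0)"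

definition is_shock :: "real \<Rightarrow> (real \<Rightarrow> real) \<Rightarrow> real \<Rightarrow> real \<Rightarrow> bool" where
  "is_shock D Z a b \<longleftrightarrow> zero_interval D Z a b \<and>
     (\<forall>a' b'. zero_interval D Z a' b' \<and> a' \<le> a \<and> b \<le> b' \<longrightarrow> a' = a \<and> b' = b)"

text \<open>The stationary equation \<open>h'(Z) Z' = h(Z)\<^sup>2\<close> is the equation
  \<open>\<zeta>\<^sub>t - (1 - \<zeta>)\<^sup>2 (h(\<zeta>) F)\<^sub>q = 0\<close> for \<open>\<zeta>(t,q) = Z(q) < 1\<close>, expanded using \<open>F\<^sub>q = - h(Z) F\<close>
  and divided by \<open>(1 - Z)\<^sup>2 F\<close>, where \<open>F\<close> is the (positive) exponential of the integral of
  \<open>h(Z)\<close> over \<open>[q,0]\<close>.\<close>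

definition stationary_piece :: "(real \<Rightarrow> real) \<Rightarrow> (real \<Rightarrow> real) \<Rightarrow> real set \<Rightarrow> bool" where
  "stationary_piece h Z I \<longleftrightarrow>
     (\<forall>q\<in>I. 0 < Z q) \<and> Z C1_differentiable_on I \<and>
     (\<forall>q\<in>I. deriv01 h (Z q) * deriv Z q = (h (Z q))\<^sup>2)"

definition piecewise_stationary :: "(real \<Rightarrow> real) \<Rightarrow> real \<Rightarrow> (real \<Rightarrow> real) \<Rightarrow> bool" where
  "piecewise_stationary h D Z \<longleftrightarrow>
     (\<exists>P. finite P \<and> {- D, 0} \<subseteq> P \<and> P \<subseteq> {- D..0} \<and>
        (\<forall>a\<in>P. \<forall>b\<in>P. a < b \<and> {a<..<b} \<inter> P = {} \<longrightarrow>
            (\<forall>q\<in>{a<..<b}. Z q = 0) \<or> stationary_piece h Z {a<..<b}) \<and>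
        (\<forall>p\<in>P. - D < p \<longrightarrow> (\<exists>l. (Z \<longlongrightarrow> l) (at_left p))) \<and>
        (\<forall>p\<in>P. p < 0 \<longrightarrow> (\<exists>l. (Z \<longlongrightarrow> l) (at_right p))))"

text \<open>Kinks and hyper-kinks: all jumps at points that do not bound an interval of zeros.
  The product is the front speed without its nonzero factor \<open>-F\<close>.\<close>

definition kinks_ok :: "(real \<Rightarrow> real) \<Rightarrow> real \<Rightarrow> (real \<Rightarrow> real) \<Rightarrow> bool" where
  "kinks_ok h D Z \<longleftrightarrow>
     (\<forall>q\<in>{- D..0}. \<forall>zm zp.
        has_left_value D Z q zm \<and> has_right_value Z q zp \<and> zm \<noteq> zp \<and>
        (\<nexists>a b. is_shock D Z a b \<and> (q = a \<or> q = b)) \<longrightarrow>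
        zp < zm \<and> (1 - zp) * (1 - zm) * ((h zm - h zp) / (zm - zp)) = 0)"

definition shock_fronts_ok :: "(real \<Rightarrow> real) \<Rightarrow> real \<Rightarrow> (real \<Rightarrow> real) \<Rightarrow> bool" where
  "shock_fronts_ok h D Z \<longleftrightarrow>
     (\<forall>a b. is_shock D Z a b \<longrightarrow>
        has_left_value D Z a 1 \<and>
        (\<exists>zp. has_right_value Z b zp \<and>
           h zp - zp * (1 - zp) * deriv01 h zp \<le> shock_psi h (b - a) \<and>
           (h zp = shock_psi h (b - a) \<or> zp = 1)))"

text \<open>The extensional function space makes \<open>Z\<close> a function on \<open>[-D,0]\<close>, so that uniqueness does not
  depend on values outside this interval.\<close>

definition stationary_profile :: "(real \<Rightarrow> real) \<Rightarrow> real \<Rightarrow> (real \<Rightarrow> real) \<Rightarrow> bool" where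
  "stationary_profile h D Z \<longleftrightarrow>
     Z \<in> {- D..0} \<rightarrow>\<^sub>E {0..1} \<and>
     Z (- D) = 1 \<and> Z 0 = 1 \<and>
     (\<forall>q\<in>{- D<..<0}. 0 \<le> Z q \<and> Z q < 1) \<and>
     (\<forall>q\<in>{- D<..<0}. \<forall>l. (Z \<longlongrightarrow> l) (at_left q) \<or> (Z \<longlongrightarrow> l) (at_right q) \<longrightarrow> l < 1) \<and>
     (\<forall>q\<in>{- D<..<0}. continuous (at_left q) Z) \<and>
     piecewise_stationary h D Z \<and> kinks_ok h D Z \<and> shock_fronts_ok h D Z"

end

theory Submission
  imports Defs
begin

text \<open>On a smooth piece \<open>1 / h(Z)\<close> has derivative \<open>- 1\<close>.  Since \<open>Z < 1\<close> on \<open>(- D, 0)\<close>, one-sided limits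
  included, and a front is stationary only if its left value is 1 (or, for a right shock front, if
  \<open>h(z\<^sup>+) = \<psi>(\<Delta>)\<close>), there are no kinks inside and a shock can only start at \<open>- D\<close>.  So \<open>Z\<close> vanishes on
  \<open>(- D, b]\<close> and satisfies \<open>1 / h(Z(q)) = 1 / h(1) - q\<close> on \<open>(b, 0)\<close>, the constant being fixed by
  \<open>Z(0-) = 1\<close>.  With \<open>\<Delta> = b + D\<close> the remaining front conditions compare
  \<open>\<Delta> + 1 / \<psi>(\<Delta>) = \<Delta> / (1 - exp (- h(0) \<Delta>))\<close> with \<open>1 / h(1) + D\<close>; the former increases strictly from
  \<open>1 / h(0)\<close>, so exactly one \<open>b\<close> fits.  If \<open>h(0) = 0\<close> then \<open>\<psi> = 0\<close> and shocks are impossible.\<close>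

section \<open>Local structure of piecewise stationary profiles\<close>

lemma partition_gap_left:
  fixes P :: "real set"
  assumes "finite P" "a \<in> P" "a < x"
  obtains p where "p \<in> P" "p < x" "{p<..<x} \<inter> P = {}"
proof
  let ?M = "Max {p \<in> P. p < x}"
  have fin: "finite {p \<in> P. p < x}" and ne: "{p \<in> P. p < x} \<noteq> {}"
    using assms by auto
  from Max_in[OF fin ne] show "?M \<in> P" "?M < x" by auto
  show "{?M<..<x} \<inter> P = {}"
    using Max_ge[OF fin] by fastforce
qed

lemma partition_gap_right:
  fixes P :: "real set"
  assumes "finite P" "a \<in> P" "x < a"
  obtains p where "p \<in> P" "x < p" "{x<..<p} \<inter> P = {}"
proof
  let ?M = "Min {p \<in> P. x < p}"
  have fin: "finite {p \<in> P. x < p}" and ne: "{p \<in> P. x < p} \<noteq> {}"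
    using assms by auto
  from Min_in[OF fin ne] show "?M \<in> P" "x < ?M" by auto
  show "{x<..<?M} \<inter> P = {}"
    using Min_le[OF fin] by fastforce
qed

lemma stationary_piece_subset:
  assumes "stationary_piece h Z I" "J \<subseteq> I"
  shows "stationary_piece h Z J"
  using assms unfolding stationary_piece_def by (meson C1_differentiable_on_subset subsetD)

lemma stationary_piece_has_derivative:
  assumes "stationary_piece h Z I" "q \<in> I"
  shows "(Z has_real_derivative deriv Z q) (at q)"
proof -
  obtain d where "(Z has_real_derivative d q) (at q)"
    using assms unfolding stationary_piece_def C1_differentiable_on_def
      has_real_derivative_iff_has_vector_derivative by blast
  then show ?thesis by (simp add: DERIV_imp_deriv)
qed

lemma has_real_derivative_zero_on_interval:
  assumes "\<forall>q\<in>{a<..<b}. Z q = (0::real)" "q \<in> {a<..<b}"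
  shows "(Z has_real_derivative 0) (at q)"
  by (rule has_field_derivative_transform_within_open[of "\<lambda>_. 0" 0 q "{a<..<b}"])
     (use assms in auto)

text \<open>Replaces pairs of consecutive partition points by facts about single points, the form in
  which the uniqueness argument consults the partition. Away from \<open>P\<close> the profile is
  locally differentiable, hence continuous, so one-sided limits exist there as well. The finite set
  \<open>P\<close> is kept as the exceptional set for differentiation.\<close>

lemma piecewise_stationary_local:
  assumes "piecewise_stationary h D Z" "D > 0"
  obtains P where "finite P"
    "\<And>q. \<lbrakk>- D < q; q < 0; q \<notin> P\<rbrakk> \<Longrightarrow> \<exists>a b. - D \<le> a \<and> a < q \<and> q < b \<and> b \<le> 0 \<and>
        ((\<forall>x\<in>{a<..<b}. Z x = 0) \<or> stationary_piece h Z {a<..<b})"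
    "\<And>q. \<lbrakk>- D < q; q \<le> 0\<rbrakk> \<Longrightarrow> \<exists>a. - D \<le> a \<and> a < q \<and>
        ((\<forall>x\<in>{a<..<q}. Z x = 0) \<or> stationary_piece h Z {a<..<q})"
    "\<And>q. \<lbrakk>- D < q; q \<le> 0\<rbrakk> \<Longrightarrow> \<exists>l. (Z \<longlongrightarrow> l) (at_left q)"
    "\<And>q. \<lbrakk>- D \<le> q; q < 0\<rbrakk> \<Longrightarrow> \<exists>l. (Z \<longlongrightarrow> l) (at_right q)"
proof -
  obtain P where P: "finite P" "{- D, 0} \<subseteq> P" "P \<subseteq> {- D..0}"
    and pieces: "\<forall>a\<in>P. \<forall>b\<in>P. a < b \<and> {a<..<b} \<inter> P = {} \<longrightarrow>
        (\<forall>q\<in>{a<..<b}. Z q = 0) \<or> stationary_piece h Z {a<..<b}"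
    and left: "\<forall>p\<in>P. - D < p \<longrightarrow> (\<exists>l. (Z \<longlongrightarrow> l) (at_left p))"
    and right: "\<forall>p\<in>P. p < 0 \<longrightarrow> (\<exists>l. (Z \<longlongrightarrow> l) (at_right p))"
    using assms(1) unfolding piecewise_stationary_def by (elim exE conjE) (rule that)
  from P(2) have ends: "- D \<in> P" "0 \<in> P" by auto
  have mid: "\<exists>a b. - D \<le> a \<and> a < q \<and> q < b \<and> b \<le> 0 \<and>
      ((\<forall>x\<in>{a<..<b}. Z x = 0) \<or> stationary_piece h Z {a<..<b})"
    if q: "- D < q" "q < 0" "q \<notin> P" for q
  proof -
    obtain a where a: "a \<in> P" "a < q" "{a<..<q} \<inter> P = {}"
      using partition_gap_left[OF P(1) ends(1) q(1)] by blast
    obtain b where b: "b \<in> P" "q < b" "{q<..<b} \<inter> P = {}"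
      using partition_gap_right[OF P(1) ends(2) q(2)] by blast
    have "{a<..<b} \<subseteq> {a<..<q} \<union> {q} \<union> {q<..<b}" by auto
    with a b q have "{a<..<b} \<inter> P = {}" by blast
    moreover have "a < b" using a b by simp
    ultimately have "(\<forall>x\<in>{a<..<b}. Z x = 0) \<or> stationary_piece h Z {a<..<b}"
      using pieces a(1) b(1) by blast
    then show ?thesis using a b P(3) by (intro exI[of _ a] exI[of _ b]) auto
  qed
  have cont: "isCont Z q" if q: "- D < q" "q < 0" "q \<notin> P" for q
  proof -
    obtain a b where ab: "a < q" "q < b"
      "(\<forall>x\<in>{a<..<b}. Z x = 0) \<or> stationary_piece h Z {a<..<b}"
      using mid[OF q] by blast
    then have "q \<in> {a<..<b}" by simp
    with ab(3) show ?thesis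
      using has_real_derivative_zero_on_interval stationary_piece_has_derivative DERIV_isCont
      by metis
  qed
  show thesis
  proof (rule that[of P])
    show "finite P" by fact
    show "\<exists>a b. - D \<le> a \<and> a < q \<and> q < b \<and> b \<le> 0 \<and>
      ((\<forall>x\<in>{a<..<b}. Z x = 0) \<or> stationary_piece h Z {a<..<b})"
      if q: "- D < q" "q < 0" "q \<notin> P" for q using mid[OF q] .
    show "\<exists>a. - D \<le> a \<and> a < q \<and> ((\<forall>x\<in>{a<..<q}. Z x = 0) \<or> stationary_piece h Z {a<..<q})"
      if q: "- D < q" "q \<le> 0" for q
    proof (cases "q \<in> P")
      case True
      obtain a where a: "a \<in> P" "a < q" "{a<..<q} \<inter> P = {}"
        using partition_gap_left[OF P(1) ends(1) q(1)] by blast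
      with pieces True have "(\<forall>x\<in>{a<..<q}. Z x = 0) \<or> stationary_piece h Z {a<..<q}"
        by blast
      then show ?thesis using a P(3) by (intro exI[of _ a]) auto
    next
      case False
      with q ends(2) have "q < 0" by (cases "q = 0") auto
      from mid[OF q(1) this False] obtain a b where ab: "- D \<le> a" "a < q" "q < b"
        "(\<forall>x\<in>{a<..<b}. Z x = 0) \<or> stationary_piece h Z {a<..<b}" by blast
      have "{a<..<q} \<subseteq> {a<..<b}" using ab by auto
      with ab stationary_piece_subset show ?thesis by (intro exI[of _ a]) blast
    qed
    show "\<exists>l. (Z \<longlongrightarrow> l) (at_left q)" if q: "- D < q" "q \<le> 0" for q
    proof (cases "q \<in> P")
      case False
      with q ends(2) have "q < 0" by (cases "q = 0") auto
      from cont[OF q(1) this False] show ?thesis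
        unfolding isCont_def filterlim_at_split by blast
    qed (use left q in blast)
    show "\<exists>l. (Z \<longlongrightarrow> l) (at_right q)" if q: "- D \<le> q" "q < 0" for q
    proof (cases "q \<in> P")
      case False
      with q ends(1) have "- D < q" by (cases "q = - D") auto
      from cont[OF this q(2) False] show ?thesis
        unfolding isCont_def filterlim_at_split by blast
    qed (use right q in blast)
  qed
qed

section \<open>Zero intervals and their extension to shocks\<close>

lemma zero_intervalI:
  assumes "- D \<le> a" "a < b" "b \<le> 0" "\<And>q. \<lbrakk>a < q; q < b\<rbrakk> \<Longrightarrow> Z q = 0"
  shows "zero_interval D Z a b"
  using assms by (auto simp: zero_interval_def)

text \<open>All zero intervals containing (a, b) overlap there, so their union is again a zero
  interval, and the largest one. Its ends are the infimum and the supremum formed below.\<close>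

lemma zero_interval_extends_to_shock:
  assumes "zero_interval D Z a b"
  obtains a' b' where "is_shock D Z a' b'" "a' \<le> a" "b \<le> b'"
proof -
  let ?A = "{a'. \<exists>b'. zero_interval D Z a' b' \<and> a' \<le> a \<and> b \<le> b'}"
  let ?B = "{b'. \<exists>a'. zero_interval D Z a' b' \<and> a' \<le> a \<and> b \<le> b'}"
  have aA: "a \<in> ?A" and bB: "b \<in> ?B" using assms by auto
  have bddA: "bdd_below ?A" by (rule bdd_belowI[of _ "- D"]) (auto simp: zero_interval_def)
  have bddB: "bdd_above ?B" by (rule bdd_aboveI[of _ 0]) (auto simp: zero_interval_def)
  have Aa: "Inf ?A \<le> a" and Bb: "b \<le> Sup ?B"
    using cInf_lower[OF aA bddA] cSup_upper[OF bB bddB] by auto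
  have DA: "- D \<le> Inf ?A" using aA by (intro cInf_greatest) (auto simp: zero_interval_def)
  have B0: "Sup ?B \<le> 0" using bB by (intro cSup_least) (auto simp: zero_interval_def)
  have ab: "a < b" using assms by (simp add: zero_interval_def)
  have zero: "Z q = 0" if q: "Inf ?A < q" "q < Sup ?B" for q
  proof -
    obtain a1 b1 where 1: "zero_interval D Z a1 b1" "a1 \<le> a" "b \<le> b1" "a1 < q"
      using cInf_lessD[OF _ q(1)] aA by blast
    obtain a2 b2 where 2: "zero_interval D Z a2 b2" "a2 \<le> a" "b \<le> b2" "q < b2"
      using less_cSupD[OF _ q(2)] bB by blast
    \<comment> \<open>Either \<open>q < b1\<close> and the first interval contains \<open>q\<close>,
      or \<open>q >= b1 >= b > a >= a2\<close> and the second one does.\<close>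
    show ?thesis
    proof (cases "q < b1")
      case True
      with 1 show ?thesis by (auto simp: zero_interval_def)
    next
      case False
      with 1 2 ab show ?thesis by (auto simp: zero_interval_def)
    qed
  qed
  have "Inf ?A < Sup ?B" using Aa Bb ab by linarith
  from zero_intervalI[OF DA this B0 zero] have zi: "zero_interval D Z (Inf ?A) (Sup ?B)" .
  have "is_shock D Z (Inf ?A) (Sup ?B)"
    unfolding is_shock_def
  proof (intro conjI allI impI)
    fix a' b' assume *: "zero_interval D Z a' b' \<and> a' \<le> Inf ?A \<and> Sup ?B \<le> b'"
    then have "a' \<in> ?A" "b' \<in> ?B" using Aa Bb by auto
    from cInf_lower[OF this(1) bddA] cSup_upper[OF this(2) bddB] *
    show "a' = Inf ?A" "b' = Sup ?B" by auto
  qed (rule zi)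
  from that[OF this Aa Bb] show thesis .
qed

lemma tendsto_in_unit:
  assumes "(Z \<longlongrightarrow> l) F" "eventually (\<lambda>q. Z q \<in> {0..1::real}) F" "F \<noteq> bot"
  shows "l \<in> {0..1}"
  using Lim_in_closed_set[OF closed_atLeastAtMost assms(2,3,1)] .

text \<open>Separates the analysis of profiles from the origin of \<open>h\<close> in
  \<open>g\<close>. Derivatives are required only inside (0, 1): smooth pieces take their values
  there, and the admissibility condition multiplies the derivative by z (1 - z), which vanishes at
  both ends.\<close>

locale erosion_speed =
  fixes h h' :: "real \<Rightarrow> real"
  assumes h_cont: "continuous_on {0..1} h"
    and h_mono: "strict_mono_on {0..1} h"
    and h_nonneg: "0 \<le> h 0"
    and h_deriv: "\<And>z. \<lbrakk>0 < z; z < 1\<rbrakk> \<Longrightarrow> (h has_real_derivative h' z) (at z)"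
    and h'_cont: "continuous_on {0<..<1} h'"
    and h'_pos: "\<And>z. \<lbrakk>0 < z; z < 1\<rbrakk> \<Longrightarrow> 0 < h' z"
begin

section \<open>Monotonicity, range and derivative of the speed\<close>

lemma h_less: "\<lbrakk>0 \<le> x; x < y; y \<le> 1\<rbrakk> \<Longrightarrow> h x < h y"
  using h_mono by (auto simp: strict_mono_on_def)

lemma h_le: "\<lbrakk>0 \<le> x; x \<le> y; y \<le> 1\<rbrakk> \<Longrightarrow> h x \<le> h y"
  using h_less[of x y] by (cases "x = y") auto

lemma h_eq_iff: "\<lbrakk>0 \<le> x; x \<le> 1; 0 \<le> y; y \<le> 1\<rbrakk> \<Longrightarrow> h x = h y \<longleftrightarrow> x = y"
  using h_less by (metis less_irrefl linorder_less_linear)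

lemma h_inj: "inj_on h {0..1}"
  by (auto simp: inj_on_def h_eq_iff)

lemma h0_less_h1: "h 0 < h 1"
  by (simp add: h_less)

lemma h1_pos: "0 < h 1"
  using h0_less_h1 h_nonneg by linarith

lemma h_image: "h ` {0..1} = {h 0..h 1}"
proof
  show "h ` {0..1} \<subseteq> {h 0..h 1}" by (auto simp: h_le)
  show "{h 0..h 1} \<subseteq> h ` {0..1}"
  proof
    fix y assume "y \<in> {h 0..h 1}"
    then show "y \<in> h ` {0..1}" using IVT'[of h 0 y 1] h_cont by auto
  qed
qed

lemma deriv01_eq:
  assumes "0 < z" "z < 1"
  shows "deriv01 h z = h' z"
proof -
  have "z \<in> interior {0..1}" using assms by simp
  then have "deriv01 h z = vector_derivative h (at z)"
    unfolding deriv01_def by (simp only: at_within_interior)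
  also have "\<dots> = h' z"
    using h_deriv[OF assms]
    by (simp add: has_real_derivative_iff_has_vector_derivative vector_derivative_at)
  finally show ?thesis .
qed

subsection \<open>Position of the right shock front\<close>

lemma shock_psi_zero: "h 0 = 0 \<Longrightarrow> shock_psi h s = 0"
  by (simp add: shock_psi_def)

text \<open>This is the strict inequality exp x > 1 + x at x = h(0) s.\<close>

lemma shock_psi_greater:
  assumes "0 < h 0" "0 < s"
  shows "h 0 < shock_psi h s"
proof -
  have "1 + h 0 * s < exp (h 0 * s)"
    using exp_minus_greater[of "- (h 0 * s)"] assms by auto
  then show ?thesis using assms by (simp add: shock_psi_def field_simps)
qed

lemma shock_psi_ge: "0 \<le> s \<Longrightarrow> h 0 \<le> shock_psi h s"
  using shock_psi_greater[of s] h_nonneg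
  by (cases "h 0 = 0"; cases "s = 0") (auto simp: shock_psi_def)

text \<open>With s = b + D, stationarity \<open>shock_psi h s * (1 / h 1 - b) = 1\<close> reads 1 /
  \<open>shock_psi h s\<close> = 1 / h(1) + D - s. Moving s to the left leaves a right-hand side
  that no longer depends on b.\<close>

definition front_balance :: "real \<Rightarrow> real" where
  "front_balance s = s + 1 / shock_psi h s"

lemma front_balance_eq:
  assumes "0 < h 0" "0 < s"
  shows "front_balance s = s / (1 - exp (- (h 0 * s)))"
proof -
  have "1 < exp (h 0 * s)" using assms by simp
  then show ?thesis using assms
    by (simp add: front_balance_def shock_psi_def exp_minus divide_simps) (simp add: algebra_simps)
qed

text \<open>In the closed form of \<open>front_balance_eq\<close> the numerator of the derivative is
  exp(-x) (exp x - 1 - x) with x = h(0) s, which is positive.\<close>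

lemma front_balance_strict_mono:
  assumes h0: "0 < h 0" and "0 < s" "s < t"
  shows "front_balance s < front_balance t"
proof -
  let ?f = "\<lambda>s. s / (1 - exp (- (h 0 * s)))"
  have "\<exists>y. (?f has_real_derivative y) (at x) \<and> y > 0" if "s \<le> x" for x
  proof (intro exI conjI)
    have x: "0 < h 0 * x" using assms that by simp
    then have e: "exp (- (h 0 * x)) < 1" by simp
    have "(1 - exp (- (h 0 * x)) - x * (h 0 * exp (- (h 0 * x))))
      = exp (- (h 0 * x)) * (exp (h 0 * x) - 1 - h 0 * x)"
      by (simp add: algebra_simps flip: exp_add)
    also have "\<dots> > 0"
      using exp_minus_greater[of "- (h 0 * x)"] x by auto
    finally show "0 < (1 - exp (- (h 0 * x)) - x * (h 0 * exp (- (h 0 * x))))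
      / (1 - exp (- (h 0 * x)))\<^sup>2" using e by (intro divide_pos_pos) auto
    show "(?f has_real_derivative (1 - exp (- (h 0 * x)) - x * (h 0 * exp (- (h 0 * x))))
      / (1 - exp (- (h 0 * x)))\<^sup>2) (at x)"
      using e by (auto intro!: derivative_eq_intros simp: power2_eq_square)
  qed
  then have "?f s < ?f t" by (rule DERIV_pos_imp_increasing[OF \<open>s < t\<close>])
  then show ?thesis
    using front_balance_eq[OF h0, of s] front_balance_eq[OF h0, of t] assms(2,3) by simp
qed

text \<open>Follows from 1 - exp(-x) < x at x = h(0) s. The bound is the limit of
  \<open>front_balance\<close> as s tends to 0 and marks the threshold between profiles without and
  with a shock.\<close>

lemma front_balance_greater:
  assumes h0: "0 < h 0" and s: "0 < s"
  shows "1 / h 0 < front_balance s"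
proof -
  have "1 - exp (- (h 0 * s)) < h 0 * s" "0 < 1 - exp (- (h 0 * s))"
    using exp_minus_greater[of "h 0 * s"] assms by auto
  then show ?thesis using assms by (simp add: front_balance_eq field_simps)
qed

text \<open>Supplies a point where \<open>front_balance\<close> lies below a prescribed level, as
  needed for the intermediate value theorem.\<close>

lemma front_balance_less:
  assumes h0: "0 < h 0" and s: "0 < s"
  shows "front_balance s < s + 1 / h 0"
  using shock_psi_greater[OF assms] h0 by (simp add: front_balance_def frac_less2)

text \<open>\<open>b\<close> is the right end of the shock, and \<open>b = - D\<close> encodes a profile without shock.  The
  reciprocal of \<open>h\<close> at the smooth part is \<open>1 / h 1 - q\<close>.\<close>

definition front_at :: "real \<Rightarrow> real \<Rightarrow> bool" where
  "front_at D b \<longleftrightarrow> - D \<le> b \<and> b \<le> 0 \<and>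
     (b = - D \<longrightarrow> h 0 * (1 / h 1 + D) \<le> 1) \<and>
     (- D < b \<and> b < 0 \<longrightarrow> shock_psi h (b + D) * (1 / h 1 - b) = 1) \<and>
     (b = 0 \<longrightarrow> h 1 \<le> shock_psi h D)"

text \<open>For h(0) > 0 all speeds involved can be inverted, so the three cases become comparisons
  with the single number 1 / h(1) + D: no shock when it is small, a shock filling the whole interval
  when it is large.\<close>

lemma front_at_iff_balance:
  assumes h0: "0 < h 0" and D: "0 < D"
  shows "front_at D b \<longleftrightarrow> - D \<le> b \<and> b \<le> 0 \<and>
     (b = - D \<longrightarrow> 1 / h 1 + D \<le> 1 / h 0) \<and>
     (- D < b \<and> b < 0 \<longrightarrow> front_balance (b + D) = 1 / h 1 + D) \<and>
     (b = 0 \<longrightarrow> front_balance D \<le> 1 / h 1 + D)"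
proof -
  have "h 0 * (1 / h 1 + D) \<le> 1 \<longleftrightarrow> 1 / h 1 + D \<le> 1 / h 0"
    using h0 by (simp add: pos_le_divide_eq mult.commute)
  moreover have "shock_psi h (b + D) * (1 / h 1 - b) = 1 \<longleftrightarrow> front_balance (b + D) = 1 / h 1 + D"
    if "- D < b"
  proof -
    have "shock_psi h (b + D) > 0" using shock_psi_greater[of "b + D"] h0 that by simp
    then have "shock_psi h (b + D) * (1 / h 1 - b) = 1 \<longleftrightarrow> 1 / h 1 - b = 1 / shock_psi h (b + D)"
      by (auto simp: eq_divide_eq mult.commute)
    then show ?thesis by (auto simp: front_balance_def)
  qed
  moreover have "h 1 \<le> shock_psi h D \<longleftrightarrow> front_balance D \<le> 1 / h 1 + D"
    using shock_psi_greater[OF h0 D] h0 h1_pos by (simp add: front_balance_def field_simps)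
  ultimately show ?thesis unfolding front_at_def by blast
qed

lemma ex1_front_at:
  assumes D: "0 < D"
  shows "\<exists>!b. front_at D b"
proof (cases "h 0 = 0")
  case True
  \<comment> \<open>With \<open>shock_psi\<close> identically 0 the conditions for
    \<open>b > - D\<close> fail, and the one for \<open>b = - D\<close> is trivial.\<close>
  then have "front_at D b \<longleftrightarrow> b = - D" for b
    using D h1_pos by (auto simp: front_at_def shock_psi_zero)
  then show ?thesis by simp
next
  case False
  with h_nonneg have h0: "0 < h 0" by simp
  note iff = front_at_iff_balance[OF h0 D]
  let ?r = "1 / h 1 + D"
  \<comment> \<open>The larger candidate \<open>c\<close> needs
    \<open>front_balance (c + D) <= ?r\<close>, but \<open>b\<close> forces the strict converse:
    through the lower bound 1 / h(0) if \<open>b = - D\<close>, through strict monotonicity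
    otherwise.\<close>
  have *: "b < c \<Longrightarrow> front_at D b \<Longrightarrow> front_at D c \<Longrightarrow> False" for b c
  proof -
    assume bc: "b < c" and b: "front_at D b" and c: "front_at D c"
    have "- D < c" "- D \<le> b" "c \<le> 0" "b < 0" using b c bc by (auto simp: iff)
    then have "front_balance (c + D) \<le> ?r" using c by (cases "c = 0") (auto simp: iff)
    moreover have "?r < front_balance (c + D)"
    proof (cases "b = - D")
      case True
      with b front_balance_greater[OF h0, of "c + D"] \<open>- D < c\<close> show ?thesis by (simp add: iff)
    next
      case False
      with b \<open>- D \<le> b\<close> \<open>b < 0\<close> have "front_balance (b + D) = ?r" by (simp add: iff)
      with front_balance_strict_mono[OF h0, of "b + D" "c + D"] bc \<open>- D \<le> b\<close> False
      show ?thesis by simp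
    qed
    ultimately show False by simp
  qed
  have "\<exists>b. front_at D b"
  proof (cases "?r \<le> 1 / h 0")
    case True
    then have "front_at D (- D)" using D by (simp add: iff)
    then show ?thesis ..
  next
    case r: False
    show ?thesis
    proof (cases "front_balance D \<le> ?r")
      case True
      then have "front_at D 0" using D by (simp add: iff)
      then show ?thesis ..
    next
      case False
      \<comment> \<open>At this \<open>s\<close> the bound of \<open>front_balance_less\<close>
        equals \<open>?r\<close>, and h(0) < h(1) gives \<open>s < D\<close>. The size of the shock
        is then found between \<open>s\<close> and \<open>D\<close>.\<close>
      define s where "s = ?r - 1 / h 0"
      have s: "0 < s" using r by (simp add: s_def)
      have "1 / h 1 < 1 / h 0" using h0 h0_less_h1 by (simp add: frac_less2)
      then have sD: "s < D" by (simp add: s_def)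
      have "front_balance s \<le> ?r" using front_balance_less[OF h0 s] by (simp add: s_def)
      moreover have "continuous_on {s..D} front_balance"
      proof -
        have "continuous_on {s..D} (\<lambda>s. s / (1 - exp (- (h 0 * s))))"
          using s h0 by (intro continuous_intros) auto
        then show ?thesis
          by (rule continuous_on_eq) (use s h0 in \<open>auto simp: front_balance_eq\<close>)
      qed
      ultimately obtain x where x: "s \<le> x" "x \<le> D" "front_balance x = ?r"
        using IVT'[of front_balance s ?r D] False sD by auto
      with False have "x \<noteq> D" by auto
      with x s have "front_at D (x - D)" by (simp add: iff)
      then show ?thesis ..
    qed
  qed
  then show ?thesis using * by (metis linorder_neqE_linordered_idom)
qed

subsection \<open>Existence\<close>

lemma h_inv_cont: "continuous_on {h 0..h 1} (inv_into {0..1} h)"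
  unfolding h_image[symmetric]
  by (rule continuous_on_inv[OF h_cont compact_Icc]) (simp add: inv_into_f_f[OF h_inj])

text \<open>The integrated equation 1 / h(Z) = 1 / h(1) - q solved for Z. The inverse is genuine
  only while its argument lies in the range of \<open>h\<close>; for q <= 0 this is
  \<open>h 0 * (1 / h 1 - q) <= 1\<close>, written as a product so that h(0) = 0 is covered.\<close>

definition smooth_part :: "real \<Rightarrow> real" where
  "smooth_part q = inv_into {0..1} h (1 / (1 / h 1 - q))"

text \<open>The end values are fixed first, so \<open>b = - D\<close> produces no zeros and
  \<open>b = 0\<close> makes the whole open interval a shock. Taking 0 at an interior
  \<open>b\<close> itself gives left continuity there.\<close>

definition profile_with_front :: "real \<Rightarrow> real \<Rightarrow> real \<Rightarrow> real" where
  "profile_with_front D b = (\<lambda>q\<in>{- D..0}.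
     if q = - D \<or> q = 0 then 1 else if q \<le> b then 0 else smooth_part q)"

lemma smooth_denom_pos: "q \<le> 0 \<Longrightarrow> 0 < 1 / h 1 - q"
  using h1_pos by (smt (verit) zero_less_divide_1_iff)

lemma smooth_speed_bounds:
  assumes "h 0 * (1 / h 1 - q) \<le> 1" "q \<le> 0"
  shows "1 / (1 / h 1 - q) \<in> {h 0..h 1}"
proof -
  note pos = smooth_denom_pos[OF assms(2)]
  have "1 / (1 / h 1 - q) \<le> 1 / (1 / h 1)"
    using assms(2) h1_pos pos by (intro divide_left_mono mult_pos_pos) auto
  then show ?thesis using assms(1) pos by (simp add: pos_le_divide_eq)
qed

lemma smooth_part_in:
  assumes "h 0 * (1 / h 1 - q) \<le> 1" "q \<le> 0"
  shows "0 \<le> smooth_part q" "smooth_part q \<le> 1" "h (smooth_part q) = 1 / (1 / h 1 - q)"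
proof -
  have *: "1 / (1 / h 1 - q) \<in> h ` {0..1}"
    using smooth_speed_bounds[OF assms] by (simp only: h_image)
  from inv_into_into[OF *] show "0 \<le> smooth_part q" "smooth_part q \<le> 1"
    by (auto simp: smooth_part_def)
  from f_inv_into_f[OF *] show "h (smooth_part q) = 1 / (1 / h 1 - q)"
    by (simp add: smooth_part_def)
qed

lemma smooth_part_eqI:
  assumes "0 \<le> z" "z \<le> 1" "h z = 1 / (1 / h 1 - q)"
  shows "z = smooth_part q"
  unfolding smooth_part_def assms(3)[symmetric]
  by (rule inv_into_f_f[symmetric]) (use assms h_inj in auto)

lemma smooth_part_0: "smooth_part 0 = 1"
  by (rule smooth_part_eqI[symmetric]) auto

lemma smooth_part_less_1:
  assumes "h 0 * (1 / h 1 - q) \<le> 1" "q < 0"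
  shows "smooth_part q < 1"
proof -
  have "1 / (1 / h 1 - q) < 1 / (1 / h 1)"
    using assms(2) h1_pos by (intro frac_less2) auto
  then have "h (smooth_part q) < h 1" using smooth_part_in(3)[of q] assms by simp
  then show ?thesis using smooth_part_in(2)[of q] assms by (cases "smooth_part q = 1") auto
qed

lemma smooth_part_pos:
  assumes "h 0 * (1 / h 1 - q) < 1" "q \<le> 0"
  shows "0 < smooth_part q"
proof -
  have "h 0 < 1 / (1 / h 1 - q)"
    using assms(1) smooth_denom_pos[OF assms(2)] by (simp add: pos_less_divide_eq)
  then have "h 0 < h (smooth_part q)" using smooth_part_in(3)[of q] assms by simp
  then show ?thesis using smooth_part_in(1)[of q] assms by (cases "smooth_part q = 0") auto
qed

lemma smooth_part_cont:
  assumes "h 0 * (1 / h 1 - b) \<le> 1"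
  shows "continuous_on {b..0} smooth_part"
proof -
  have "h 0 * (1 / h 1 - q) \<le> 1" if "b \<le> q" for q
    using mult_left_mono[of "1 / h 1 - q" "1 / h 1 - b" "h 0"] h_nonneg assms that by linarith
  then have "(\<lambda>q. 1 / (1 / h 1 - q)) ` {b..0} \<subseteq> {h 0..h 1}"
    using smooth_speed_bounds by auto
  moreover have "continuous_on {b..0} (\<lambda>q. 1 / (1 / h 1 - q))"
    using smooth_denom_pos by (intro continuous_intros) fastforce
  ultimately show ?thesis
    using continuous_on_compose2[OF h_inv_cont] unfolding smooth_part_def by blast
qed

text \<open>The inverse function contributes 1 / h'(z), and \<open>1 / (1 / h 1 - q)\<close> has its
  own square as derivative; the product is the stationary equation. The strict hypotheses keep z
  inside (0, 1).\<close>

lemma smooth_part_deriv: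
  assumes "h 0 * (1 / h 1 - q) < 1" "q < 0"
  shows "(smooth_part has_real_derivative (h (smooth_part q))\<^sup>2 / h' (smooth_part q)) (at q)"
proof -
  define y where "y = 1 / (1 / h 1 - q)"
  define z where "z = smooth_part q"
  note z = smooth_part_in[of q, folded z_def y_def] smooth_part_less_1[of q, folded z_def]
    smooth_part_pos[of q, folded z_def]
  have z01: "0 < z" "z < 1" and hz: "h z = y" using z assms by auto
  then have y: "h 0 < y" "y < h 1" using h_less[of 0 z] h_less[of z 1] by auto
  have zy: "inv_into {0..1} h y = z" by (simp add: z_def smooth_part_def y_def)
  have "(inv_into {0..1} h has_real_derivative inverse (h' z)) (at y)"
  proof (rule DERIV_inverse_function[where f = h and a = "h 0" and b = "h 1"])
    show "(h has_real_derivative h' z) (at (inv_into {0..1} h y))"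
      unfolding zy by (rule h_deriv[OF z01])
    show "h' z \<noteq> 0" using h'_pos[OF z01] by simp
    show "h (inv_into {0..1} h x) = x" if "h 0 < x" "x < h 1" for x
      by (rule f_inv_into_f) (use that h_image in auto)
    show "isCont (inv_into {0..1} h) y"
      by (rule continuous_on_interior[OF h_inv_cont]) (use y in auto)
  qed (use y in auto)
  moreover have "((\<lambda>q. 1 / (1 / h 1 - q)) has_real_derivative y\<^sup>2) (at q)"
    unfolding y_def using smooth_denom_pos[of q] assms
    by (auto intro!: derivative_eq_intros simp: power2_eq_square)
  ultimately have "((\<lambda>q. inv_into {0..1} h (1 / (1 / h 1 - q))) has_real_derivative
      inverse (h' z) * y\<^sup>2) (at q)"
    unfolding y_def by (rule DERIV_chain2)
  then show ?thesis
    unfolding smooth_part_def[abs_def, symmetric] z_def[symmetric] hz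
    by (simp add: divide_inverse mult.commute)
qed

text \<open>Ensures that \<open>smooth_part\<close> is a genuine inverse on all of [b, 0]. At an
  interior front the product with \<open>shock_psi\<close> equals 1, and \<open>shock_psi\<close> is
  at least h(0).\<close>

lemma front_at_bound:
  assumes "front_at D b" "b < 0"
  shows "h 0 * (1 / h 1 - b) \<le> 1"
proof (cases "b = - D")
  case True
  then show ?thesis using assms by (simp add: front_at_def)
next
  case False
  then have "shock_psi h (b + D) * (1 / h 1 - b) = 1" "0 \<le> b + D"
    using assms by (auto simp: front_at_def)
  then show ?thesis
    using mult_right_mono[OF shock_psi_ge[of "b + D"], of "1 / h 1 - b"] smooth_denom_pos[of b]
      assms by simp
qed

lemma smooth_bound_strict:
  assumes "h 0 * (1 / h 1 - b) \<le> 1" "b < q"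
  shows "h 0 * (1 / h 1 - q) < 1"
proof (cases "h 0 = 0")
  case False
  then have "h 0 * (1 / h 1 - q) < h 0 * (1 / h 1 - b)"
    using h_nonneg assms by (intro mult_strict_left_mono) auto
  then show ?thesis using assms by simp
qed simp

text \<open>The only possible shock is (-D, b), and the only jump away from shock fronts is the drop
  from 1 at -D when \<open>b = - D\<close>. One-sided limits are computed first; the conditions are
  then checked one by one.\<close>

lemma stationary_profile_with_front:
  assumes D: "0 < D" and front: "front_at D b"
  shows "stationary_profile h D (profile_with_front D b)"
proof -
  let ?Z = "profile_with_front D b"
  have b: "- D \<le> b" "b \<le> 0" using front by (auto simp: front_at_def)
  have Z_ends: "?Z (- D) = 1" "?Z 0 = 1" using D by (auto simp: profile_with_front_def)
  have Z_zero: "?Z q = 0" if "- D < q" "q < 0" "q \<le> b" for q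
    using that by (auto simp: profile_with_front_def)
  have Z_smooth: "?Z q = smooth_part q" if "b < q" "q < 0" for q
    using that b by (auto simp: profile_with_front_def)
  note bound = front_at_bound[OF front]
  have strict: "h 0 * (1 / h 1 - q) < 1" if "b < q" "q < 0" for q
    using smooth_bound_strict[OF bound] that by simp
  have smooth_pos: "0 < smooth_part q" if "b < q" "q < 0" for q
    using smooth_part_pos[OF strict] that by simp
  have smooth_lt: "smooth_part q < 1" if "b \<le> q" "q < 0" for q
    using smooth_part_less_1 strict[of q] bound that by (cases "q = b") auto
  have cont: "continuous_on {b..0} smooth_part" if "b < 0"
    using smooth_part_cont bound that by blast

  have left_b: "(?Z \<longlongrightarrow> 0) (at_left q)" if "- D < q" "q \<le> b" for q
    by (rule tendsto_eventually, rule eventually_mono[OF eventually_at_left_real[OF that(1)]])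
       (use that b in \<open>auto intro!: Z_zero\<close>)
  have right_b: "(?Z \<longlongrightarrow> 0) (at_right q)" if "- D \<le> q" "q < b" for q
    by (rule tendsto_eventually, rule eventually_mono[OF eventually_at_right_real[OF that(2)]])
       (use that b in \<open>auto intro!: Z_zero\<close>)
  \<comment> \<open>Continuity of \<open>smooth_part\<close> on the closed interval [b, 0] also
    yields the limit at 0 here and the right limit at \<open>b\<close> in the next fact.\<close>
  have left_s: "(?Z \<longlongrightarrow> smooth_part q) (at_left q)" if "b < q" "q \<le> 0" for q
  proof -
    have "(smooth_part \<longlongrightarrow> smooth_part q) (at q within {b..0})"
      using cont that by (auto simp: continuous_on_def)
    then have "(smooth_part \<longlongrightarrow> smooth_part q) (at q within {b..q})"
      by (rule tendsto_within_subset) (use that in auto)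
    then have "(smooth_part \<longlongrightarrow> smooth_part q) (at_left q)"
      using that by (simp add: at_within_Icc_at_left)
    then show ?thesis
      by (rule Lim_transform_eventually)
         (rule eventually_mono[OF eventually_at_left_real[OF that(1)]],
          use that in \<open>auto simp: Z_smooth\<close>)
  qed
  have right_s: "(?Z \<longlongrightarrow> smooth_part q) (at_right q)" if "b \<le> q" "q < 0" for q
  proof -
    have "(smooth_part \<longlongrightarrow> smooth_part q) (at q within {b..0})"
      using cont that by (auto simp: continuous_on_def)
    then have "(smooth_part \<longlongrightarrow> smooth_part q) (at q within {q..0})"
      by (rule tendsto_within_subset) (use that in auto)
    then have "(smooth_part \<longlongrightarrow> smooth_part q) (at_right q)"
      using that by (simp add: at_within_Icc_at_right)
    then show ?thesis
      by (rule Lim_transform_eventually)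
         (rule eventually_mono[OF eventually_at_right_real[OF that(2)]],
          use that in \<open>auto simp: Z_smooth\<close>)
  qed
  have zi_le: "b' \<le> b" if zi: "zero_interval D ?Z a' b'" for a' b'
  proof (rule ccontr)
    assume "\<not> b' \<le> b"
    \<comment> \<open>A point of (a', b') beyond \<open>b\<close>, where the profile is
      positive.\<close>
    define q where "q = (max a' b + b') / 2"
    have "a' < b'" "b' \<le> 0" using zi by (auto simp: zero_interval_def)
    with \<open>\<not> b' \<le> b\<close> have q: "a' < q" "q < b'" "b < q" "q < 0" by (auto simp: q_def)
    then have "?Z q = 0" using zi by (simp add: zero_interval_def)
    with Z_smooth[OF q(3,4)] smooth_pos[OF q(3,4)] show False by simp
  qed
  have zi_max: "zero_interval D ?Z (- D) b" if "- D < b"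
    by (rule zero_intervalI) (use that b in \<open>auto intro!: Z_zero\<close>)
  have shock: "is_shock D ?Z a' b' \<longleftrightarrow> a' = - D \<and> b' = b \<and> - D < b" for a' b'
  proof
    assume sh: "is_shock D ?Z a' b'"
    then have zi: "zero_interval D ?Z a' b'" by (simp add: is_shock_def)
    then have "- D \<le> a'" "a' < b'" "b' \<le> b" using zi_le by (auto simp: zero_interval_def)
    then show "a' = - D \<and> b' = b \<and> - D < b" using sh zi_max by (auto simp: is_shock_def)
  next
    assume "a' = - D \<and> b' = b \<and> - D < b"
    then show "is_shock D ?Z a' b'"
      unfolding is_shock_def using zi_max zi_le
      by (metis antisym zero_interval_def)
  qed
  have piece: "stationary_piece h ?Z {b<..<0}"
  proof -
    let ?d = "\<lambda>q. (h (smooth_part q))\<^sup>2 / h' (smooth_part q)"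
    have der: "(?Z has_real_derivative ?d q) (at q)" if "b < q" "q < 0" for q
      by (rule has_field_derivative_transform_within_open
            [OF smooth_part_deriv[OF strict[OF that] that(2)], of "{b<..<0}"])
         (use that in \<open>auto simp: Z_smooth\<close>)
    have "continuous_on {b<..<0} ?d"
    proof (cases "b < 0")
      case True
      have sp: "continuous_on {b<..<0} smooth_part"
        by (rule continuous_on_subset[OF cont[OF True]]) auto
      have sp01: "smooth_part ` {b<..<0} \<subseteq> {0<..<1}"
        using smooth_pos smooth_lt by auto
      have hc: "continuous_on {b<..<0} (\<lambda>q. h (smooth_part q))"
        by (rule continuous_on_compose2[OF h_cont sp]) (use sp01 in force)
      have h'c: "continuous_on {b<..<0} (\<lambda>q. h' (smooth_part q))"
        by (rule continuous_on_compose2[OF h'_cont sp sp01])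
      show ?thesis
        using sp01 h'_pos by (intro continuous_intros hc h'c) force
    qed simp
    then have "?Z C1_differentiable_on {b<..<0}"
      unfolding C1_differentiable_on_def
      using der by (intro exI[of _ ?d]) (auto simp: has_real_derivative_iff_has_vector_derivative)
    moreover have "deriv01 h (?Z q) * deriv ?Z q = (h (?Z q))\<^sup>2" if "b < q" "q < 0" for q
      using that smooth_pos[of q] smooth_lt[of q] h'_pos[of "smooth_part q"]
      by (simp add: Z_smooth DERIV_imp_deriv[OF der] deriv01_eq)
    ultimately show ?thesis
      unfolding stationary_piece_def using smooth_pos Z_smooth by auto
  qed
  have left_val: "l = ?Z q" if "- D < q" "q < 0" "(?Z \<longlongrightarrow> l) (at_left q)" for q l
  proof (rule tendsto_unique[OF _ that(3)])
    show "(?Z \<longlongrightarrow> ?Z q) (at_left q)"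
      using left_b[of q] left_s[of q] Z_zero[of q] Z_smooth[of q] that(1,2)
      by (cases "q \<le> b") simp_all
  qed simp
  have range: "0 \<le> ?Z q" "?Z q < 1" if "- D < q" "q < 0" for q
    using that Z_zero[of q] Z_smooth[of q] smooth_pos[of q] smooth_lt[of q]
    by (cases "q \<le> b"; simp)+
  have right_val: "l = (if q < b then 0 else smooth_part q)"
    if "- D \<le> q" "q < 0" "(?Z \<longlongrightarrow> l) (at_right q)" for q l
  proof (rule tendsto_unique[OF _ that(3)])
    show "(?Z \<longlongrightarrow> (if q < b then 0 else smooth_part q)) (at_right q)"
      using right_b[of q] right_s[of q] that(1,2) by (cases "q < b") simp_all
  qed simp
  show ?thesis
    unfolding stationary_profile_def
  proof (intro conjI ballI allI impI)
    show "?Z \<in> {- D..0} \<rightarrow>\<^sub>E {0..1}"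
    proof
      fix q assume "q \<in> {- D..0}"
      then consider "q = - D" | "q = 0" | "- D < q" "q < 0" by fastforce
      then show "?Z q \<in> {0..1}"
        using Z_ends range[of q] by cases auto
    qed (auto simp: profile_with_front_def)
    show "l < 1" if q: "q \<in> {- D<..<0}"
      and l: "(?Z \<longlongrightarrow> l) (at_left q) \<or> (?Z \<longlongrightarrow> l) (at_right q)" for q l
      using l
    proof
      assume "(?Z \<longlongrightarrow> l) (at_left q)"
      then show ?thesis using left_val[of q l] range[of q] q by auto
    next
      assume "(?Z \<longlongrightarrow> l) (at_right q)"
      then show ?thesis using right_val[of q l] smooth_lt[of q] q by auto
    qed
    show "continuous (at_left q) ?Z" if "q \<in> {- D<..<0}" for q
      using that left_b[of q] left_s[of q]
      by (cases "q \<le> b") (auto simp: continuous_within Z_zero Z_smooth)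
    show "piecewise_stationary h D ?Z"
      unfolding piecewise_stationary_def
    proof (intro exI[of _ "{- D, b, 0}"] conjI ballI impI)
      show "\<exists>l. (?Z \<longlongrightarrow> l) (at_left p)" if "p \<in> {- D, b, 0}" "- D < p" for p
        using that b left_b[of p] left_s[of p] by (cases "p \<le> b") auto
      show "\<exists>l. (?Z \<longlongrightarrow> l) (at_right p)" if "p \<in> {- D, b, 0}" "p < 0" for p
        using that b right_b[of p] right_s[of p] by (cases "p < b") auto
      show "(\<forall>q\<in>{x<..<y}. ?Z q = 0) \<or> stationary_piece h ?Z {x<..<y}"
        if "x \<in> {- D, b, 0}" "y \<in> {- D, b, 0}" "x < y \<and> {x<..<y} \<inter> {- D, b, 0} = {}" for x y
      proof -
        \<comment> \<open>A gap of the partition avoids \<open>b\<close>, so it lies to the left of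
          \<open>b\<close> or is (b, 0). This remains true when \<open>b\<close> coincides with an
          end point.\<close>
        have "b \<notin> {x<..<y}" using that(3) by blast
        with that b D consider "y \<le> b" | "x = b" "y = 0" by fastforce
        then show ?thesis
        proof cases
          case 1
          then show ?thesis using that b D by (auto intro!: Z_zero)
        next
          case 2
          then show ?thesis using piece by simp
        qed
      qed
    qed (use b D in auto)
    show "kinks_ok h D ?Z"
      unfolding kinks_ok_def
    proof (intro ballI allI impI)
      fix q zm zp
      assume q: "q \<in> {- D..0}" and as: "has_left_value D ?Z q zm \<and> has_right_value ?Z q zp \<and> zm \<noteq> zp \<and>
        (\<nexists>a b. is_shock D ?Z a b \<and> (q = a \<or> q = b))"
      then have lv: "has_left_value D ?Z q zm" and rv: "has_right_value ?Z q zp" and ne: "zm \<noteq> zp"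
        and nsh: "- D < b \<Longrightarrow> q \<noteq> - D \<and> q \<noteq> b" by (auto simp: shock)
      consider "q = - D" | "q = 0" | "- D < q" "q < 0" using q by fastforce
      then show "zp < zm \<and> (1 - zp) * (1 - zm) * ((h zm - h zp) / (zm - zp)) = 0"
      proof cases
        \<comment> \<open>Without a shock the jump at -D starts from the boundary value 1, so the
          factor 1 - zm of the speed vanishes.\<close>
        case 1
        with nsh b have "b = - D" by (cases "- D < b") auto
        have "zm = 1" using lv 1 Z_ends by (simp add: has_left_value_def)
        moreover have "zp < 1"
          using rv 1 D right_val[of q zp] smooth_lt[of q] \<open>b = - D\<close>
          by (simp add: has_right_value_def)
        ultimately show ?thesis by simp
      next
        \<comment> \<open>The point 0 is not a shock front only if \<open>b < 0\<close>; then
          \<open>smooth_part\<close> reaches 1 continuously and there is no jump.\<close>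
        case 2
        with nsh b D have "b < 0" by (cases "b = 0") auto
        have "zm = 1"
          using lv 2 D left_s[of 0] \<open>b < 0\<close> tendsto_unique[of "at_left 0" ?Z zm 1]
          by (simp add: has_left_value_def smooth_part_0)
        moreover have "zp = 1" using rv 2 Z_ends by (simp add: has_right_value_def)
        ultimately show ?thesis using ne by simp
      next
        case 3
        then have "zm = ?Z q" "zp = (if q < b then 0 else smooth_part q)"
          using lv rv left_val right_val by (auto simp: has_left_value_def has_right_value_def)
        moreover have "q \<noteq> b" using nsh 3 b by (cases "- D < b") auto
        ultimately have "zm = zp" using 3 Z_zero[of q] Z_smooth[of q] by (cases "q < b") auto
        then show ?thesis using ne by simp
      qed
    qed
    show "shock_fronts_ok h D ?Z"
      unfolding shock_fronts_ok_def shock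
    proof (intro allI impI, elim conjE, intro conjI)
      fix a' b' assume ab: "a' = - D" "b' = b" "- D < b"
      show "has_left_value D ?Z a' 1" using ab Z_ends by (simp add: has_left_value_def)
      show "\<exists>zp. has_right_value ?Z b' zp \<and>
          h zp - zp * (1 - zp) * deriv01 h zp \<le> shock_psi h (b' - a') \<and>
          (h zp = shock_psi h (b' - a') \<or> zp = 1)"
      proof (cases "b = 0")
        case True
        \<comment> \<open>At right value 1 the derivative term vanishes, and admissibility becomes
          the condition of \<open>front_at\<close> for \<open>b = 0\<close>.\<close>
        then show ?thesis
          using ab front Z_ends by (intro exI[of _ 1]) (simp add: has_right_value_def front_at_def)
      next
        case False
        with b have "b < 0" by simp
        define z where "z = smooth_part b"
        have z: "0 \<le> z" "z < 1" "h z = 1 / (1 / h 1 - b)"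
          using smooth_part_in[OF bound] smooth_lt[of b] \<open>b < 0\<close> by (auto simp: z_def)
        have "shock_psi h (b' - a') * (1 / h 1 - b) = 1"
          using front ab \<open>b < 0\<close> by (simp add: front_at_def)
        then have "h z = shock_psi h (b' - a')"
          unfolding z(3) using smooth_denom_pos[of b] b(2)
          by (metis less_irrefl nonzero_eq_divide_eq)
        \<comment> \<open>Since h(z) equals the shock value, admissibility only asks that the
          subtracted term be nonnegative; the factor z settles z = 0.\<close>
        moreover have "0 \<le> z * (1 - z) * deriv01 h z"
          using z h'_pos[of z] by (cases "z = 0") (auto simp: deriv01_eq)
        moreover have "has_right_value ?Z b' z"
          using right_s[of b] \<open>b < 0\<close> ab by (simp add: has_right_value_def z_def)
        ultimately show ?thesis by (intro exI[of _ z]) auto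
      qed
    qed
  qed (use Z_ends range in auto)
qed

subsection \<open>Uniqueness\<close>

text \<open>The candidate \<open>b\<close> is the right end of the only shock, or \<open>- D\<close>
  if there is none. Continuity and positivity beyond \<open>b\<close> make 1 / h(Z) + q constant
  there, and the front conditions at \<open>b\<close> then turn into
  \<open>front_at\<close>.\<close>

lemma stationary_profile_is_with_front:
  assumes D: "0 < D" and prof: "stationary_profile h D Z"
  obtains b where "front_at D b" "Z = profile_with_front D b"
proof -
  from prof have Z_fun: "Z \<in> {- D..0} \<rightarrow>\<^sub>E {0..1}" and Z_ends: "Z (- D) = 1" "Z 0 = 1"
    and Z_in: "\<And>q. q \<in> {- D<..<0} \<Longrightarrow> 0 \<le> Z q \<and> Z q < 1"
    and lim_lt: "\<And>q l. q \<in> {- D<..<0} \<Longrightarrow>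
      (Z \<longlongrightarrow> l) (at_left q) \<or> (Z \<longlongrightarrow> l) (at_right q) \<Longrightarrow> l < 1"
    and left_cont: "\<And>q. q \<in> {- D<..<0} \<Longrightarrow> continuous (at_left q) Z"
    and pw: "piecewise_stationary h D Z"
    and kinks: "kinks_ok h D Z" and fronts: "shock_fronts_ok h D Z"
    unfolding stationary_profile_def by auto
  obtain P where P: "finite P"
    and mid: "\<And>q. \<lbrakk>- D < q; q < 0; q \<notin> P\<rbrakk> \<Longrightarrow> \<exists>a b. - D \<le> a \<and> a < q \<and> q < b \<and> b \<le> 0 \<and>
        ((\<forall>x\<in>{a<..<b}. Z x = 0) \<or> stationary_piece h Z {a<..<b})"
    and left_piece: "\<And>q. \<lbrakk>- D < q; q \<le> 0\<rbrakk> \<Longrightarrow> \<exists>a. - D \<le> a \<and> a < q \<and>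
        ((\<forall>x\<in>{a<..<q}. Z x = 0) \<or> stationary_piece h Z {a<..<q})"
    and left_lim: "\<And>q. \<lbrakk>- D < q; q \<le> 0\<rbrakk> \<Longrightarrow> \<exists>l. (Z \<longlongrightarrow> l) (at_left q)"
    and right_lim: "\<And>q. \<lbrakk>- D \<le> q; q < 0\<rbrakk> \<Longrightarrow> \<exists>l. (Z \<longlongrightarrow> l) (at_right q)"
    by (rule piecewise_stationary_local[OF pw D]) (rule that)
  have ev_left: "eventually (\<lambda>x. Z x \<in> {0..1}) (at_left q)" if "- D < q" "q \<le> 0" for q
    by (rule eventually_mono[OF eventually_at_left_real[OF that(1)]])
       (use that Z_in in \<open>fastforce simp: less_imp_le\<close>)
  have ev_right: "eventually (\<lambda>x. Z x \<in> {0..1}) (at_right q)" if "- D \<le> q" "q < 0" for q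
    by (rule eventually_mono[OF eventually_at_right_real[OF that(2)]])
       (use that Z_in in \<open>fastforce simp: less_imp_le\<close>)

  text \<open>The left value at the left front of a shock is 1, a value not attained inside.\<close>
  have shock_left: "a = - D" if "is_shock D Z a b" for a b
  proof (rule ccontr)
    assume "a \<noteq> - D"
    have "- D \<le> a" "a < b" "b \<le> 0" using that by (auto simp: is_shock_def zero_interval_def)
    with \<open>a \<noteq> - D\<close> have a: "a \<in> {- D<..<0}" by auto
    have "has_left_value D Z a 1" using fronts that by (auto simp: shock_fronts_ok_def)
    with \<open>a \<noteq> - D\<close> have "(Z \<longlongrightarrow> 1) (at_left a)" by (simp add: has_left_value_def)
    with lim_lt[OF a] show False by blast
  qed
  \<comment> \<open>All shocks start at -D, so maximality makes any two of them equal, and the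
    common right end bounds every zero interval.\<close>
  obtain b where b: "- D \<le> b" "b \<le> 0" and b_shock: "- D < b \<Longrightarrow> is_shock D Z (- D) b"
    and b_max: "\<And>x y. zero_interval D Z x y \<Longrightarrow> y \<le> b"
  proof (cases "\<exists>x y. zero_interval D Z x y")
    case False
    show thesis by (rule that[of "- D"]) (use False D in auto)
  next
    case True
    then obtain a1 b1 where "is_shock D Z a1 b1"
      by (meson zero_interval_extends_to_shock)
    then have sh: "is_shock D Z (- D) b1" using shock_left by blast
    then have zi: "zero_interval D Z (- D) b1" by (simp add: is_shock_def)
    show thesis
    proof (rule that[OF _ _ sh])
      show "- D \<le> b1" "b1 \<le> 0" using zi by (auto simp: zero_interval_def)
      fix x y assume "zero_interval D Z x y"
      then obtain a2 b2 where "is_shock D Z a2 b2" "y \<le> b2"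
        by (meson zero_interval_extends_to_shock)
      then have sh2: "is_shock D Z (- D) b2" using shock_left by blast
      then have zi2: "zero_interval D Z (- D) b2" by (simp add: is_shock_def)
      have "b2 \<le> b1"
      proof (rule ccontr)
        assume "\<not> b2 \<le> b1"
        then have "b1 \<le> b2" by simp
        with sh zi2 have "b2 = b1" unfolding is_shock_def by blast
        with \<open>\<not> b2 \<le> b1\<close> show False by simp
      qed
      with \<open>y \<le> b2\<close> show "y \<le> b1" by simp
    qed
  qed
  have no_front: "\<nexists>x y. is_shock D Z x y \<and> (q = x \<or> q = y)" if "b < q" for q
  proof (rule notI, elim exE conjE)
    fix x y assume sh: "is_shock D Z x y" and q: "q = x \<or> q = y"
    then have "zero_interval D Z x y" by (simp add: is_shock_def)
    then have "x < y" "y \<le> b" using b_max by (auto simp: zero_interval_def)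
    with q that show False by auto
  qed
  have left_stat: "\<exists>a. - D \<le> a \<and> a < q \<and> stationary_piece h Z {a<..<q}" if "b < q" "q \<le> 0" for q
  proof -
    from left_piece[of q] that b obtain a where a: "- D \<le> a" "a < q"
      "(\<forall>x\<in>{a<..<q}. Z x = 0) \<or> stationary_piece h Z {a<..<q}" by auto
    have "\<not> (\<forall>x\<in>{a<..<q}. Z x = 0)"
      using b_max[of a q] a that by (auto simp: zero_interval_def)
    with a show ?thesis by blast
  qed
  have mid_stat: "\<exists>x y. q \<in> {x<..<y} \<and> stationary_piece h Z {x<..<y}"
    if "b < q" "q < 0" "q \<notin> P" for q
  proof -
    from mid[of q] that b obtain x y where xy: "- D \<le> x" "x < q" "q < y" "y \<le> 0"
      "(\<forall>z\<in>{x<..<y}. Z z = 0) \<or> stationary_piece h Z {x<..<y}" by auto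
    have "\<not> (\<forall>z\<in>{x<..<y}. Z z = 0)"
      using b_max[of x y] xy that by (auto simp: zero_interval_def)
    with xy show ?thesis by auto
  qed
  \<comment> \<open>Both one-sided limits are below 1, so a jump of zero speed would need equal
    values of \<open>h\<close>, against injectivity. Left continuity identifies the common limit
    with the value of \<open>Z\<close>.\<close>
  have Z_cont: "isCont Z q" if q: "b < q" "q < 0" for q
  proof -
    have qD: "q \<in> {- D<..<0}" using q b by auto
    obtain zm where zm: "(Z \<longlongrightarrow> zm) (at_left q)" using left_lim[of q] qD by auto
    obtain zp where zp: "(Z \<longlongrightarrow> zp) (at_right q)" using right_lim[of q] qD by auto
    have m: "zm \<in> {0..1}" "zm < 1"
      using tendsto_in_unit[OF zm] ev_left[of q] lim_lt[OF qD] zm qD by auto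
    have p: "zp \<in> {0..1}" "zp < 1"
      using tendsto_in_unit[OF zp] ev_right[of q] lim_lt[OF qD] zp qD by auto
    have "zm = zp"
    proof (rule ccontr)
      assume ne: "zm \<noteq> zp"
      have "has_left_value D Z q zm" "has_right_value Z q zp"
        using zm zp qD by (auto simp: has_left_value_def has_right_value_def)
      with kinks ne no_front[OF q(1)] qD
      have "(1 - zp) * (1 - zm) * ((h zm - h zp) / (zm - zp)) = 0"
        unfolding kinks_ok_def by (metis atLeastAtMost_iff greaterThanLessThan_iff less_imp_le)
      then show False using ne m p h_eq_iff[of zm zp] by auto
    qed
    moreover have "zm = Z q"
      using tendsto_unique[OF _ zm, of "Z q"] left_cont[OF qD] by (simp add: continuous_within)
    ultimately show ?thesis unfolding isCont_def filterlim_at_split using zm zp by simp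
  qed
  \<comment> \<open>A partition point could still carry the value 0 between positive pieces. This is
    excluded because h'(Z) Z' >= 0 makes \<open>Z\<close> nondecreasing on the piece to its left, so
    by continuity the value at \<open>q\<close> is at least a positive one.\<close>
  have Z_pos: "0 < Z q" if q: "b < q" "q < 0" for q
  proof -
    obtain a where a: "- D \<le> a" "a < q" "stationary_piece h Z {a<..<q}"
      using left_stat[of q] q by auto
    define x where "x = (a + q) / 2"
    have x: "a < x" "x < q" using a(2) by (auto simp: x_def)
    have "Z x \<le> Z y" if "x < y" "y < q" for y
    proof (rule DERIV_nonneg_imp_nondecreasing[where f = Z and a = x and b = y])
      fix t assume "x \<le> t" "t \<le> y"
      then have t: "t \<in> {a<..<q}" using x that by auto
      have t01: "0 < Z t" "Z t < 1"
        using a(3) t Z_in[of t] a(1) q by (auto simp: stationary_piece_def)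
      have "deriv01 h (Z t) * deriv Z t = (h (Z t))\<^sup>2"
        using a(3) t by (auto simp: stationary_piece_def)
      then have "0 \<le> h' (Z t) * deriv Z t" by (simp add: deriv01_eq[OF t01])
      then have "0 \<le> deriv Z t" using h'_pos[OF t01] by (simp add: zero_le_mult_iff)
      then show "\<exists>d. (Z has_real_derivative d) (at t) \<and> 0 \<le> d"
        using stationary_piece_has_derivative[OF a(3) t] by blast
    qed (use that in simp)
    then have "eventually (\<lambda>y. Z x \<le> Z y) (at_left q)"
      by (intro eventually_mono[OF eventually_at_left_real[OF x(2)]]) auto
    moreover have "(Z \<longlongrightarrow> Z q) (at_left q)"
      using Z_cont[OF q] unfolding isCont_def filterlim_at_split by simp
    ultimately have "Z x \<le> Z q" by (intro tendsto_lowerbound) auto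
    moreover have "0 < Z x" using a(3) x by (auto simp: stationary_piece_def)
    ultimately show ?thesis by simp
  qed
  have Z01: "0 < Z q" "Z q < 1" if "b < q" "q < 0" for q
    using Z_pos[OF that] Z_in[of q] that b by auto
  have hZ_pos: "0 < h (Z q)" if "b < q" "q < 0" for q
    using h_less[of 0 "Z q"] h_nonneg Z01[OF that] by simp
  have hZ_ne: "h (Z q) \<noteq> 0" if "b < q" "q < 0" for q
    using hZ_pos[OF that] by simp
  have speed: "h (Z q) = 1 / (1 / h 1 - q)" if q: "b < q" "q < 0" for q
  proof -
    \<comment> \<open>The derivative of \<open>?u\<close> is 0 off the finite set \<open>P\<close>;
      continuity of \<open>Z\<close> carries the constant across the points of
      \<open>P\<close>.\<close>
    let ?u = "\<lambda>q. 1 / h (Z q) + q"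
    have "b < 0" using q by simp
    have "?u constant_on {b<..<0}"
    proof (rule DERIV_zero_connected_constant_on[OF _ _ P])
      have "continuous_on {b<..<0} Z"
        using Z_cont by (intro continuous_at_imp_continuous_on) auto
      then have "continuous_on {b<..<0} (\<lambda>q. h (Z q))"
        by (rule continuous_on_compose2[OF h_cont]) (use Z01 in \<open>force simp: less_imp_le\<close>)
      then show "continuous_on {b<..<0} ?u"
        by (intro continuous_intros) (use hZ_ne in auto)
      show "\<forall>x\<in>{b<..<0} - P. DERIV ?u x :> 0"
      proof
        fix x assume x: "x \<in> {b<..<0} - P"
        then obtain s t where st: "x \<in> {s<..<t}" "stationary_piece h Z {s<..<t}"
          using mid_stat[of x] by auto
        have x01: "0 < Z x" "Z x < 1" "0 < h (Z x)" using Z01[of x] hZ_pos[of x] x by auto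
        have eq: "h' (Z x) * deriv Z x = (h (Z x))\<^sup>2"
          using st unfolding stationary_piece_def deriv01_eq[OF x01(1,2), symmetric] by blast
        have "((\<lambda>q. h (Z q)) has_real_derivative h' (Z x) * deriv Z x) (at x)"
          by (rule DERIV_chain2[OF h_deriv[OF x01(1,2)] stationary_piece_has_derivative[OF st(2,1)]])
        then have "((\<lambda>q. h (Z q)) has_real_derivative (h (Z x))\<^sup>2) (at x)" by (simp only: eq)
        then show "DERIV ?u x :> 0"
          using x01(3) by (auto intro!: derivative_eq_intros simp: power2_eq_square)
      qed
    qed auto
    then obtain c where c: "\<And>x. b < x \<Longrightarrow> x < 0 \<Longrightarrow> ?u x = c"
      unfolding constant_on_def by auto
    obtain l where l: "(Z \<longlongrightarrow> l) (at_left 0)" using left_lim[of 0] D by auto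
    have l01: "l \<in> {0..1}" using tendsto_in_unit[OF l] ev_left[of 0] D by auto
    \<comment> \<open>A left limit below 1 at 0 would be an upward jump, which only the right front
      of a shock may have; none ends there because \<open>b < 0\<close>.\<close>
    have "l = 1"
    proof (rule ccontr)
      assume ne: "l \<noteq> 1"
      have "has_left_value D Z 0 l" "has_right_value Z 0 1"
        using l D Z_ends by (auto simp: has_left_value_def has_right_value_def)
      moreover have "0 \<in> {- D..0}" using D by simp
      ultimately have "1 < l"
        using kinks ne no_front[OF \<open>b < 0\<close>] unfolding kinks_ok_def by blast
      then show False using l01 by simp
    qed
    then have "((\<lambda>q. h (Z q)) \<longlongrightarrow> h 1) (at_left 0)"
      using continuous_on_tendsto_compose[OF h_cont l] ev_left[of 0] D by simp
    then have "(?u \<longlongrightarrow> 1 / h 1 + 0) (at_left 0)"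
      using h1_pos by (intro tendsto_intros) auto
    moreover have "(?u \<longlongrightarrow> c) (at_left 0)"
      by (rule tendsto_eventually, rule eventually_mono[OF eventually_at_left_real[OF \<open>b < 0\<close>]])
         (use c in auto)
    ultimately have "c = 1 / h 1" using tendsto_unique[of "at_left (0::real)" ?u] by simp
    with c[OF q] have "1 / h (Z q) = 1 / h 1 - q" by simp
    then show ?thesis by (metis divide_divide_eq_right div_by_1 mult_1)
  qed
  \<comment> \<open>The shock is an open interval; left continuity adds the value at
    \<open>b\<close> itself.\<close>
  have Z_zero: "Z q = 0" if q: "- D < q" "q < 0" "q \<le> b" for q
  proof -
    have zi: "zero_interval D Z (- D) b" using b_shock q by (simp add: is_shock_def)
    have "(Z \<longlongrightarrow> 0) (at_left q)"
      by (rule tendsto_eventually, rule eventually_mono[OF eventually_at_left_real[OF q(1)]])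
         (use zi q in \<open>auto simp: zero_interval_def\<close>)
    moreover have "(Z \<longlongrightarrow> Z q) (at_left q)"
      using left_cont[of q] q by (simp add: continuous_within)
    ultimately show ?thesis using tendsto_unique[of "at_left q" Z] by simp
  qed
  have "Z q = profile_with_front D b q" for q
  proof -
    consider "q \<notin> {- D..0}" | "q = - D" | "q = 0" | "- D < q" "q < 0" "q \<le> b" | "b < q" "- D < q" "q < 0"
      using b by fastforce
    then show ?thesis
    proof cases
      case 1
      then show ?thesis using PiE_arb[OF Z_fun 1]
        unfolding profile_with_front_def by (simp only: restrict_apply if_False)
    next
      case 5
      then have "Z q = smooth_part q" using smooth_part_eqI Z01[of q] speed[of q] by simp
      with 5 show ?thesis by (simp add: profile_with_front_def)
    qed (use Z_ends Z_zero D in \<open>auto simp: profile_with_front_def\<close>)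
  qed
  then have Z_eq: "Z = profile_with_front D b" by blast
  have right_speed: "((\<lambda>q. 1 / (1 / h 1 - q)) \<longlongrightarrow> 1 / (1 / h 1 - b)) (at_right b)"
    using smooth_denom_pos[OF b(2)] by (intro tendsto_intros) auto
  \<comment> \<open>The speed formula holds only to the right of \<open>b\<close>; continuity of
    \<open>h\<close> passes it to the right limit at \<open>b\<close>.\<close>
  have lim_b: "h z = 1 / (1 / h 1 - b)" if z: "(Z \<longlongrightarrow> z) (at_right b)" and "b < 0" for z
  proof -
    have ev: "eventually (\<lambda>x. Z x \<in> {0..1}) (at_right b)" using ev_right[of b] b \<open>b < 0\<close> by simp
    have "z \<in> {0..1}" by (rule tendsto_in_unit[OF z ev]) simp
    from continuous_on_tendsto_compose[OF h_cont z this ev]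
    have "((\<lambda>q. h (Z q)) \<longlongrightarrow> h z) (at_right b)" .
    moreover have "((\<lambda>q. h (Z q)) \<longlongrightarrow> 1 / (1 / h 1 - b)) (at_right b)"
      by (rule Lim_transform_eventually[OF right_speed],
          rule eventually_mono[OF eventually_at_right_real[OF \<open>b < 0\<close>]])
         (auto simp: speed)
    ultimately show ?thesis using tendsto_unique[of "at_right b" "\<lambda>q. h (Z q)"] by simp
  qed
  have "front_at D b"
    unfolding front_at_def
  proof (intro conjI impI)
    \<comment> \<open>Without a shock the right limit z at -D is nonnegative, so h(0) <= h(z), which
      is the required bound.\<close>
    assume bD: "b = - D"
    then have "b < 0" using D by simp
    obtain z where z: "(Z \<longlongrightarrow> z) (at_right b)" using right_lim[of b] b \<open>b < 0\<close> by auto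
    have "eventually (\<lambda>x. Z x \<in> {0..1}) (at_right b)" using ev_right[of b] b \<open>b < 0\<close> by simp
    then have "z \<in> {0..1}" using tendsto_in_unit[OF z] by simp
    then have "h 0 \<le> 1 / (1 / h 1 - b)" using h_le[of 0 z] lim_b[OF z \<open>b < 0\<close>] by simp
    then show "h 0 * (1 / h 1 + D) \<le> 1"
      using smooth_denom_pos[OF b(2)] bD by (simp add: pos_le_divide_eq)
  next
    \<comment> \<open>Inside the interval the right value is below 1, so of the two ways to be
      stationary only equality with \<open>shock_psi\<close> remains.\<close>
    assume mid_b: "- D < b \<and> b < 0"
    then obtain z where "has_right_value Z b z" "h z = shock_psi h (b + D) \<or> z = 1"
      using fronts b_shock unfolding shock_fronts_ok_def by force
    moreover from this mid_b have z: "(Z \<longlongrightarrow> z) (at_right b)" by (simp add: has_right_value_def)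
    moreover have "z < 1" using lim_lt[of b z] z mid_b by auto
    ultimately have "shock_psi h (b + D) = 1 / (1 / h 1 - b)" using lim_b mid_b by auto
    then show "shock_psi h (b + D) * (1 / h 1 - b) = 1" using smooth_denom_pos[OF b(2)] by simp
  next
    \<comment> \<open>The right value is the boundary value 1, where the derivative term of the
      admissibility condition vanishes.\<close>
    assume "b = 0"
    then obtain z where "has_right_value Z 0 z"
      "h z - z * (1 - z) * deriv01 h z \<le> shock_psi h D"
      using fronts b_shock D unfolding shock_fronts_ok_def by force
    then show "h 1 \<le> shock_psi h D" using Z_ends by (simp add: has_right_value_def)
  qed (use b in auto)
  with Z_eq show thesis by (rule that[rotated])
qed

lemma ex1_stationary_profile:
  assumes "0 < D"
  shows "\<exists>!Z. stationary_profile h D Z"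
  using ex1_front_at[OF assms] stationary_profile_with_front[OF assms]
    stationary_profile_is_with_front[OF assms] by metis

end

section \<open>From the concave erosion function g to the speed h\<close>

lemma erosion_speed_erosion_h:
  fixes g g' g'' :: "real \<Rightarrow> real"
  assumes g: "\<And>z. z \<in> {0..} \<Longrightarrow> (g has_real_derivative g' z) (at z within {0..})"
    and g': "\<And>z. z \<in> {0..} \<Longrightarrow> (g' has_real_derivative g'' z) (at z within {0..})"
    and g1: "g 1 = 0" and g0: "g 0 \<ge> 0"
    and neg: "\<And>z. z \<in> {0..} \<Longrightarrow> g'' z < 0"
  shows "erosion_speed (erosion_h g) (\<lambda>z. (g' z * (1 - z) + g z) / (1 - z)\<^sup>2)"
proof -
  let ?h = "erosion_h g" and ?h' = "\<lambda>z. (g' z * (1 - z) + g z) / (1 - z)\<^sup>2"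
  have at_pos: "at z within {0..} = at z" if "0 < z" for z :: real
    using that by (intro at_within_interior) simp
  have g_at: "(g has_real_derivative g' z) (at z)" if "0 < z" for z
    using g[of z] that at_pos[OF that] by simp
  have g'_at: "(g' has_real_derivative g'' z) (at z)" if "0 < z" for z
    using g'[of z] that at_pos[OF that] by simp
  have g_cont: "continuous_on {0..} g" using g by (rule DERIV_continuous_on)
  have g'_cont: "continuous_on {0..} g'" using g' by (rule DERIV_continuous_on)
  have h1: "?h 1 = - g' 1" using DERIV_imp_deriv[OF g_at[of 1]] by (simp add: erosion_h_def)
  have h_eq: "?h z = g z / (1 - z)" if "z \<noteq> 1" for z using that by (simp add: erosion_h_def)
  have g'_less: "g' y < g' x" if "0 < x" "x < y" for x y
    by (rule DERIV_neg_imp_decreasing[OF that(2)])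
       (use that g'_at neg in \<open>meson atLeast_iff less_imp_le less_le_trans\<close>)
  \<comment> \<open>The mean value theorem writes -g(z) as (1 - z) g'(x) with z < x < 1. The
    numerator is therefore (1 - z) (g'(z) - g'(x)), positive because g' decreases strictly.\<close>
  have num_pos: "0 < g' z * (1 - z) + g z" if z: "0 < z" "z < 1" for z
  proof -
    obtain x where x: "z < x" "x < 1" "g 1 - g z = (1 - z) * g' x"
      using MVT2[OF z(2), of g g'] g_at z by force
    have "(1 - z) * g' x < (1 - z) * g' z"
      using g'_less[OF z(1) x(1)] z by (intro mult_strict_left_mono) auto
    then show ?thesis using x(3) g1 by (simp add: mult.commute[of "g' z"])
  qed
  have h_der: "(?h has_real_derivative ?h' z) (at z)" if z: "0 < z" "z < 1" for z
  proof -
    have "((\<lambda>z. g z / (1 - z)) has_real_derivative ?h' z) (at z)"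
      using g_at[OF z(1)] z by (auto intro!: derivative_eq_intros simp: power2_eq_square)
    then show ?thesis
      by (rule has_field_derivative_transform_within_open[of _ _ _ "{..<1}"])
         (use z h_eq in auto)
  qed
  have "(?h \<longlongrightarrow> ?h z) (at z within {0..1})" if z: "z \<in> {0..1}" for z
  proof (cases "z = 1")
    case True
    \<comment> \<open>Since g(1) = 0, away from 1 the speed is the negated difference quotient of g
      at 1, so the value -g'(1) is its continuous extension.\<close>
    have "((\<lambda>y. (g y - g 1) / (y - 1)) \<longlongrightarrow> g' 1) (at 1)"
      using g_at[of 1] by (simp add: has_field_derivative_iff)
    then have "((\<lambda>y. - ((g y - g 1) / (y - 1))) \<longlongrightarrow> - g' 1) (at 1)"
      by (rule tendsto_minus)
    then have "(?h \<longlongrightarrow> - g' 1) (at 1)"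
      by (rule Lim_transform_eventually)
         (auto simp: eventually_at_filter h_eq g1 divide_simps algebra_simps intro!: always_eventually)
    then show ?thesis using True h1 by (simp add: Lim_at_imp_Lim_at_within)
  next
    case False
    have "continuous_on {0..<1} (\<lambda>z. g z / (1 - z))"
      by (intro continuous_intros continuous_on_subset[OF g_cont]) auto
    then have "continuous_on {0..<1} ?h"
      by (rule continuous_on_eq) (auto simp: h_eq)
    then have "(?h \<longlongrightarrow> ?h z) (at z within {0..<1})"
      using z False by (auto simp: continuous_on_def)
    moreover have "at z within {0..<1} = at z within {0..1}"
      by (rule at_within_nhd[of z "{..<1}"]) (use z False in auto)
    ultimately show ?thesis by simp
  qed
  then have h_cont: "continuous_on {0..1} ?h" by (simp add: continuous_on_def)
  show ?thesis
  proof
    show "continuous_on {0..1} ?h" by fact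
    \<comment> \<open>A positive derivative inside (0, 1) together with continuity on the closed
      interval gives strict growth up to both ends.\<close>
    show "strict_mono_on {0..1} ?h"
    proof (rule strict_mono_onI)
      fix r s :: real assume rs: "r \<in> {0..1}" "s \<in> {0..1}" "r < s"
      show "?h r < ?h s"
      proof (rule DERIV_pos_imp_increasing_open[OF rs(3)])
        show "\<exists>y. (?h has_real_derivative y) (at x) \<and> 0 < y" if "r < x" "x < s" for x
          using h_der[of x] num_pos[of x] that rs by (intro exI[of _ "?h' x"]) auto
        show "continuous_on {r..s} ?h"
          by (rule continuous_on_subset[OF h_cont]) (use rs in auto)
      qed
    qed
    show "0 \<le> ?h 0" using g0 by (simp add: h_eq)
    show "continuous_on {0<..<1} ?h'"
      by (intro continuous_intros continuous_on_subset[OF g_cont] continuous_on_subset[OF g'_cont])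
         auto
    show "0 < ?h' z" if "0 < z" "z < 1" for z
      using num_pos[OF that] that by (intro divide_pos_pos) auto
  qed (rule h_der)
qed

theorem theorem3p1:
  fixes g g' g'' :: "real \<Rightarrow> real" and D :: real
  assumes "\<And>z. z \<in> {0..} \<Longrightarrow> (g has_real_derivative g' z) (at z within {0..})"
    and "\<And>z. z \<in> {0..} \<Longrightarrow> (g' has_real_derivative g'' z) (at z within {0..})"
    and "continuous_on {0..} g''"
    and "g 1 = 0" and "g 0 \<ge> 0"
    and "\<And>z. z \<in> {0..} \<Longrightarrow> g'' z < 0"
    and "D > 0"
  shows "\<exists>!Z. stationary_profile (erosion_h g) D Z"
proof -
  interpret erosion_speed "erosion_h g" "\<lambda>z. (g' z * (1 - z) + g z) / (1 - z)\<^sup>2"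
    by (rule erosion_speed_erosion_h[OF assms(1,2,4,5,6)])
  show ?thesis by (rule ex1_stationary_profile[OF \<open>D > 0\<close>])
qed

end
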